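(* Let $b\in\frac12\mathbb{Z}$, and for positive integers $n$ let $f_n(x)=2T_n\left(\frac x2+b\right)-2b$. For positive integers $m<n$, put $d=\gcd(m,n)$, $m=dm_1$, $n=dn_1$. Then \[ \gcd(f_m(x),f_n(x))=f_d(x) \] in each of the following cases: (1) $b=0$ and $\gcd(m_1,2)=\gcd(n_1,2)=1$; (2) $b=1$; (3) $b=-1$ and $\gcd(m_1,2)=\gcd(n_1,2)=1$; (4) $b=\frac12$ and $\gcd(m_1,6)=\gcd(n_1,6)=1$; (5) $b=-\frac12$ and $\gcd(m_1,3)=\gcd(n_1,3)=1$. In all other cases, $f_m(x)$ and $f_n(x)$ are coprime.
   Context: $T_n$ is the Chebyshev polynomial of the first kind: $T_0=1$, $T_1=x$, $T_n=2xT_{n-1}-T_{n-2}$ for $n\ge2$. The gcd of polynomials is the monic greatest common divisor in $\mathbb{Q}[x]$, and coprime means having gcd equal to $1$. *)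

theory Defs
  imports
    "HOL-Computational_Algebra.Computational_Algebra"
    "HOL-Computational_Algebra.Field_as_Ring"
begin

fun chebyshev_T :: "nat \<Rightarrow> 'a::comm_ring_1 poly" where
  "chebyshev_T 0 = 1"
| "chebyshev_T (Suc 0) = [:0, 1:]"
| "chebyshev_T (Suc (Suc n)) = [:0, 2:] * chebyshev_T (Suc n) - chebyshev_T n"

definition shifted_chebyshev :: "rat \<Rightarrow> nat \<Rightarrow> rat poly" where
  "shifted_chebyshev b n = smult 2 (pcompose (chebyshev_T n) [:b, 1/2:]) - [:2 * b:]"

text \<open>
  The library's gcd on \<^typ>\<open>rat poly\<close> is normalized to be monic, hence is
  the monic greatest common divisor in the usual sense.
\<close>

lemma lead_coeff_gcd_rat_poly:
  fixes p q :: "rat poly"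
  assumes "p \<noteq> 0 \<or> q \<noteq> 0"
  shows "lead_coeff (gcd p q) = 1"
proof -
  let ?g = "gcd p q"
  have nz: "?g \<noteq> 0" using assms by simp
  have "normalize ?g = ?g" by simp
  then have "unit_factor ?g = 1" using nz
    by (metis unit_factor_normalize)
  then show ?thesis using nz
    by (simp add: unit_factor_poly_def monom_0 one_pCons)
qed

end

theory Submission
  imports Defs
begin

text \<open>
  Let \<open>P k = 2 T_k - 2 b\<close>, so that \<open>f_k\<close> is \<open>P k\<close> evaluated at \<open>x/2 + b\<close>. Since
  \<open>T_(d k) = T_k o T_d\<close>, both \<open>f_m\<close> and \<open>f_n\<close> are obtained by substituting the same
  polynomial into \<open>P m1\<close> and \<open>P n1\<close>, and by Bezout such a substitution commutes with gcds. This
  reduces the problem to coprime indices, where the gcd is \<open>x - b\<close> (substitution then gives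
  \<open>f_d\<close>, up to the factor 2) or 1.

  For coprime \<open>m < n\<close>, write a common complex root of \<open>P m\<close> and \<open>P n\<close> as \<open>(z + 1/z)/2\<close>. Then
  \<open>z^m + 1/z^m = z^n + 1/z^n = 2 b\<close>, so \<open>z^n\<close> is \<open>z^m\<close> or its inverse; hence \<open>|z| = 1\<close> and
  \<open>|b| \<le> 1\<close>. For the five remaining half-integers \<open>z^m\<close> and \<open>z^n\<close> are roots of unity of order
  dividing 6 or 4, hence so is \<open>z\<close>, and the only possible common root is \<open>b\<close> itself. It is a root
  exactly under the listed conditions on the indices, and it is simple by the Pell equation.
\<close>

subsection \<open>Extending scalars from the rationals to the complex numbers\<close>

lemma map_poly_of_rat_diff:
  "map_poly of_rat (p - q) = (map_poly of_rat p - map_poly of_rat q :: 'a::field_char_0 poly)"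
  by (intro poly_eqI) (simp add: coeff_map_poly of_rat_diff)

lemma map_poly_of_rat_mult:
  "map_poly of_rat (p * q) = (map_poly of_rat p * map_poly of_rat q :: 'a::field_char_0 poly)"
  by (intro poly_eqI) (simp add: coeff_map_poly coeff_mult of_rat_sum of_rat_mult)

lemma map_poly_of_rat_smult:
  "map_poly of_rat (smult c p) = (smult (of_rat c) (map_poly of_rat p) :: 'a::field_char_0 poly)"
  by (intro map_poly_smult) (simp_all add: of_rat_mult)

lemma poly_map_poly_of_rat:
  "poly (map_poly of_rat p) (of_rat x) = (of_rat (poly p x) :: 'a::field_char_0)"
  by (induction p) (simp_all add: map_poly_pCons of_rat_add of_rat_mult)

lemma map_poly_of_rat_root_exists:
  assumes "degree p > 0"
  obtains t :: complex where "poly (map_poly of_rat p) t = 0"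
proof -
  have "degree (map_poly of_rat p :: complex poly) = degree p"
    using assms by (intro map_poly_degree_eq) auto
  with assms show thesis
    using fundamental_theorem_of_algebra constant_degree that by (metis neq0_conv)
qed

subsection \<open>Composition and greatest common divisors\<close>

text \<open>By Bezout the gcd is \<open>u * p + v * q\<close>, so after substituting
  \<open>s\<close> every common divisor still divides it. \<open>normalize\<close> appears because
  substitution need not preserve being monic.\<close>

lemma gcd_pcompose:
  fixes p q s :: "'a::field_gcd poly"
  shows "gcd (pcompose p s) (pcompose q s) = normalize (pcompose (gcd p q) s)"
proof -
  obtain u v where uv: "u * p + v * q = gcd p q"
    using bezout_coefficients_fst_snd by blast
  obtain p' q' where p': "p = gcd p q * p'" and q': "q = gcd p q * q'"
    by (meson dvdE gcd_dvd1 gcd_dvd2)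
  show ?thesis
  proof (rule gcdI [symmetric])
    show "normalize (pcompose (gcd p q) s) dvd pcompose p s"
      by (subst (2) p') (simp add: pcompose_mult)
    show "normalize (pcompose (gcd p q) s) dvd pcompose q s"
      by (subst (2) q') (simp add: pcompose_mult)
    fix r assume "r dvd pcompose p s" "r dvd pcompose q s"
    then have "r dvd pcompose (u * p + v * q) s"
      by (simp add: pcompose_add pcompose_mult)
    then show "r dvd normalize (pcompose (gcd p q) s)"
      by (simp add: uv)
  qed simp
qed

lemma normalize_rat_poly_monic:
  fixes p :: "rat poly"
  assumes "lead_coeff p = 1"
  shows "normalize p = p"
proof -
  have "unit_factor p = 1"
    using assms by (simp add: unit_factor_poly_def monom_0 one_pCons)
  then show ?thesis
    using normalize_mult_unit_factor [of p] by simp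
qed

subsection \<open>Chebyshev polynomials\<close>

lemma map_poly_of_rat_chebyshev_T:
  "map_poly of_rat (chebyshev_T n) = (chebyshev_T n :: 'a::field_char_0 poly)"
  by (induction n rule: chebyshev_T.induct)
     (simp_all add: map_poly_pCons map_poly_of_rat_diff map_poly_of_rat_smult)

text \<open>Polynomial form of 2 cos A cos B = cos (A + B) + cos (A - B); \<open>k \<le> l\<close>
  makes the natural subtraction exact.\<close>

lemma chebyshev_T_mult_chebyshev_T:
  assumes "k \<le> l"
  shows "smult 2 (chebyshev_T l * chebyshev_T k)
    = (chebyshev_T (l + k) + chebyshev_T (l - k) :: 'a::comm_ring_1 poly)"
  using assms
proof (induction k rule: chebyshev_T.induct)
  case 1
  show ?case using smult_add_left [of 1 1 "chebyshev_T l :: 'a poly"] by simp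
next
  case 2
  then obtain i where "l = Suc i" by (cases l) auto
  moreover have "chebyshev_T (Suc i + 1) + chebyshev_T i = ([:0, 2:] * chebyshev_T (Suc i) :: 'a poly)"
    by simp
  ultimately show ?case
    by (simp add: mult.commute [of _ "[:0, 1:]"] del: chebyshev_T.simps(3))
next
  case (3 k)
  then obtain i where i: "l = Suc (Suc i) + k"
    by (metis add.commute add_2_eq_Suc le_Suc_ex add_Suc)
  have "smult 2 (chebyshev_T l * chebyshev_T (Suc (Suc k)))
      = [:0, 2:] * smult 2 (chebyshev_T l * chebyshev_T (Suc k))
        - smult 2 (chebyshev_T l * chebyshev_T k :: 'a poly)"
    by (simp add: algebra_simps smult_diff_right)
  also have "\<dots> = [:0, 2:] * (chebyshev_T (l + Suc k) + chebyshev_T (l - Suc k))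
        - (chebyshev_T (l + k) + chebyshev_T (l - k))"
    using 3 by simp
  also have "\<dots> = chebyshev_T (l + Suc (Suc k)) + chebyshev_T (l - Suc (Suc k))"
    by (simp add: i Suc_diff_le algebra_simps smult_add_right)
  finally show ?case .
qed

lemma chebyshev_T_pcompose:
  "pcompose (chebyshev_T m) (chebyshev_T n) = (chebyshev_T (n * m) :: 'a::idom poly)"
proof (induction m rule: chebyshev_T.induct)
  case 1
  show ?case by (simp add: pcompose_1)
next
  case 2
  show ?case by (simp add: pcompose_pCons)
next
  case (3 m)
  have "pcompose (chebyshev_T (Suc (Suc m))) (chebyshev_T n)
      = smult 2 (chebyshev_T (n * Suc m) * chebyshev_T n) - (chebyshev_T (n * m) :: 'a poly)"
    using 3 by (simp add: pcompose_diff pcompose_mult pcompose_pCons pcompose_smult mult.commute)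
  \<comment> \<open>The product formula with indices \<open>n * Suc m\<close> and \<open>n\<close>
    yields \<open>n * Suc (Suc m)\<close> and \<open>n * m\<close>; the latter term cancels.\<close>
  also have "\<dots> = chebyshev_T (n * Suc (Suc m))"
    by (subst chebyshev_T_mult_chebyshev_T) (simp_all add: algebra_simps)
  finally show ?case .
qed

lemma degree_chebyshev_T_le: "degree (chebyshev_T n) \<le> n"
proof (induction n rule: chebyshev_T.induct)
  case (3 n)
  have "degree ([:0, 2:] * chebyshev_T (Suc n) :: 'a poly) \<le> 1 + Suc n"
    using 3 by (intro order.trans [OF degree_mult_le] add_mono) auto
  with 3 show ?case
    unfolding chebyshev_T.simps by (intro degree_diff_le) auto
qed auto

text \<open>The successor index is essential: \<open>chebyshev_T 0\<close> does not fit the pattern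
  of leading coefficients.\<close>

lemma coeff_chebyshev_T: "coeff (chebyshev_T (Suc n)) (Suc n) = 2 ^ n"
proof (induction n)
  case (Suc n)
  have "coeff (chebyshev_T n :: 'a poly) (Suc (Suc n)) = 0"
    using degree_chebyshev_T_le [of n, where ?'a = 'a] by (intro coeff_eq_0) linarith
  with Suc show ?case by simp
qed simp

text \<open>For z = exp (i theta) this is T_n (cos theta) = cos (n theta). In general both sides
  obey the same three-term recurrence.\<close>

lemma poly_chebyshev_T_joukowski:
  fixes z :: "'a::field_char_0"
  assumes "z \<noteq> 0"
  shows "2 * poly (chebyshev_T n) ((z + inverse z) / 2) = z ^ n + inverse z ^ n"
proof (induction n rule: chebyshev_T.induct)
  case (3 n)
  let ?t = "(z + inverse z) / 2"
  have "2 * poly (chebyshev_T (Suc (Suc n))) ?t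
      = (z + inverse z) * (2 * poly (chebyshev_T (Suc n)) ?t) - 2 * poly (chebyshev_T n) ?t"
    by (simp add: algebra_simps)
  also have "\<dots> = (z + inverse z) * (z ^ Suc n + inverse z ^ Suc n) - (z ^ n + inverse z ^ n)"
    using 3 by simp
  also have "\<dots> = z ^ Suc (Suc n) + inverse z ^ Suc (Suc n)"
  proof -
    have "(z + w) * (z * u + w * v) - (u + v) = z * (z * u) + w * (w * v)" if "z * w = 1" for u v w
      using that by algebra
    from this [OF right_inverse [OF assms]] show ?thesis
      unfolding power_Suc .
  qed
  finally show ?case .
qed simp_all

text \<open>The equation says that z is a root of z^2 - 2 t z + 1, whose two roots are mutually
  inverse.\<close>

lemma joukowski_surj:
  obtains z :: complex where "z \<noteq> 0" "t = (z + inverse z) / 2"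
proof -
  have *: "(t + csqrt (t\<^sup>2 - 1)) * (t - csqrt (t\<^sup>2 - 1)) = 1"
    using power2_csqrt [of "t\<^sup>2 - 1"] by (simp add: algebra_simps power2_eq_square)
  then have "inverse (t + csqrt (t\<^sup>2 - 1)) = t - csqrt (t\<^sup>2 - 1)"
    by (rule inverse_unique)
  with * show thesis
    by (intro that [of "t + csqrt (t\<^sup>2 - 1)"]) auto
qed

text \<open>
  The companion polynomials below are the Chebyshev polynomials of the second kind, with the
  index shifted by one: \<open>chebyshev_V n\<close> is the usual \<open>U\<close> of index \<open>n - 1\<close>.
\<close>

fun chebyshev_V :: "nat \<Rightarrow> 'a::comm_ring_1 poly" where
  "chebyshev_V 0 = 0"
| "chebyshev_V (Suc n) = chebyshev_T n + [:0, 1:] * chebyshev_V n"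

text \<open>Addition formula for cos ((n + 1) theta): at x = cos theta, \<open>chebyshev_V n\<close>
  is sin (n theta) / sin theta and \<open>[:-1, 0, 1:]\<close> is -(sin theta)^2.\<close>

lemma chebyshev_T_Suc:
  "chebyshev_T (Suc n) = [:0, 1:] * chebyshev_T n + [:-1, 0, 1:] * (chebyshev_V n :: 'a::comm_ring_1 poly)"
proof (induction n)
  case (Suc n)
  define x :: "'a poly" where "x = [:0, 1:]"
  have x2: "pCons (- 1) x = x * x - 1" and x': "[:0, 2:] = x + x"
    by (simp_all add: x_def one_pCons)
  have "chebyshev_T (Suc (Suc n)) = (x + x) * chebyshev_T (Suc n) - chebyshev_T n"
    by (simp only: chebyshev_T.simps x')
  also have "\<dots> = x * chebyshev_T (Suc n) + x * (x * chebyshev_T n + (x * x - 1) * chebyshev_V n)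
      - chebyshev_T n"
    using arg_cong [OF Suc [folded x_def, unfolded x2], of "\<lambda>p. x * p"]
    by (simp only: distrib_right diff_conv_add_uminus add.assoc)
  also have "\<dots> = x * chebyshev_T (Suc n) + (x * x - 1) * (chebyshev_T n + x * chebyshev_V n)"
    by (simp add: algebra_simps)
  finally show ?case by (simp only: x2 chebyshev_V.simps flip: x_def)
qed simp

text \<open>Passing from n to n + 1 multiplies T + V sqrt (x^2 - 1) by x + sqrt (x^2 - 1), an
  element of norm 1.\<close>

lemma chebyshev_pell:
  "chebyshev_T n ^ 2 - [:-1, 0, 1:] * chebyshev_V n ^ 2 = (1 :: 'a::comm_ring_1 poly)"
proof (induction n)
  case (Suc n)
  define x :: "'a poly" where "x = [:0, 1:]"
  have x2: "pCons (- 1) x = x * x - 1"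
    by (simp add: x_def one_pCons)
  show ?case
    using Suc [folded x_def, unfolded x2]
    unfolding chebyshev_T_Suc chebyshev_V.simps x_def [symmetric] x2
    by (simp add: algebra_simps power2_eq_square)
qed simp

text \<open>The two formulas need a joint induction, since differentiating
  \<open>chebyshev_T_Suc\<close> brings in the derivative of \<open>chebyshev_V n\<close>. The
  factor x^2 - 1 avoids a division.\<close>

lemma pderiv_chebyshev:
  fixes n :: nat
  shows "pderiv (chebyshev_T n) = of_nat n * (chebyshev_V n :: 'a::idom poly)" (is ?T)
    and "[:-1, 0, 1:] * pderiv (chebyshev_V n)
      = of_nat n * chebyshev_T n - [:0, 1:] * (chebyshev_V n :: 'a::idom poly)" (is ?V)
proof -
  define x :: "'a poly" where "x = [:0, 1:]"
  have x2: "pCons (- 1) x = x * x - 1" and dx: "pderiv x = 1"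
    by (simp_all add: x_def one_pCons pderiv_pCons)
  have "?T \<and> ?V"
  proof (induction n)
    case (Suc n)
    then have T: "pderiv (chebyshev_T n) = of_nat n * (chebyshev_V n :: 'a poly)"
      and V: "(x * x - 1) * pderiv (chebyshev_V n)
        = of_nat n * chebyshev_T n - x * (chebyshev_V n :: 'a poly)"
      unfolding x_def [symmetric] x2 by blast+
    have "pderiv (chebyshev_T (Suc n)) = chebyshev_T n + x * pderiv (chebyshev_T n)
        + (x + x) * chebyshev_V n + (x * x - 1) * pderiv (chebyshev_V n :: 'a poly)"
      unfolding chebyshev_T_Suc x2 x_def [symmetric]
      by (simp add: pderiv_add pderiv_diff pderiv_mult dx algebra_simps)
    then have T': "pderiv (chebyshev_T (Suc n)) = of_nat (Suc n) * (chebyshev_V (Suc n) :: 'a poly)"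
      unfolding T V chebyshev_V.simps x_def [symmetric] by (simp add: algebra_simps)
    have "(x * x - 1) * pderiv (chebyshev_V (Suc n)) = (x * x - 1) * pderiv (chebyshev_T n)
        + (x * x - 1) * chebyshev_V n + x * ((x * x - 1) * pderiv (chebyshev_V n :: 'a poly))"
      unfolding chebyshev_V.simps x_def [symmetric]
      by (simp add: pderiv_add pderiv_mult dx algebra_simps)
    then have "(x * x - 1) * pderiv (chebyshev_V (Suc n))
        = of_nat (Suc n) * chebyshev_T (Suc n) - x * (chebyshev_V (Suc n) :: 'a poly)"
      unfolding T V chebyshev_T_Suc x2 chebyshev_V.simps x_def [symmetric]
      by (simp add: algebra_simps)
    with T' show ?case by (simp only: x2 flip: x_def)
  qed (simp add: x_def)
  then show ?T ?V by auto
qed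

lemma poly_chebyshev_T_minus_one: "poly (chebyshev_T n) (- 1) = (- 1) ^ n"
  by (induction n rule: chebyshev_T.induct) simp_all

lemma poly_chebyshev_T_one: "poly (chebyshev_T n) 1 = 1"
  by (induction n rule: chebyshev_T.induct) simp_all

lemma poly_chebyshev_V_one: "poly (chebyshev_V n) 1 = of_nat n"
  by (induction n) (simp_all add: poly_chebyshev_T_one)

lemma poly_chebyshev_V_minus_one: "poly (chebyshev_V n) (- 1) = - ((- 1) ^ n * of_nat n)"
  by (induction n) (simp_all add: poly_chebyshev_T_minus_one algebra_simps)

text \<open>The derivative is n times \<open>chebyshev_V n\<close>. If the latter vanished at
  \<open>b\<close>, the Pell equation would force b^2 = 1, but at 1 and -1 its value is n up to
  sign.\<close>

lemma chebyshev_T_fixpoint_simple: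
  fixes b :: "'a::{idom, ring_char_0}"
  assumes "poly (chebyshev_T n) b = b" "n > 0"
  shows "poly (pderiv (chebyshev_T n)) b \<noteq> 0"
proof -
  have "poly (chebyshev_V n) b \<noteq> 0"
  proof
    assume V: "poly (chebyshev_V n) b = 0"
    have "poly (chebyshev_T n ^ 2 - [:-1, 0, 1:] * chebyshev_V n ^ 2) b = 1"
      by (simp only: chebyshev_pell poly_1)
    then have "b\<^sup>2 = 1"
      by (simp add: V assms(1))
    then have "b = 1 \<or> b = - 1"
      by (simp add: power2_eq_1_iff)
    with V assms(2) show False
      by (auto simp: poly_chebyshev_V_one poly_chebyshev_V_minus_one)
  qed
  with assms(2) show ?thesis
    by (simp add: pderiv_chebyshev(1) poly_of_nat)
qed

subsection \<open>Fixed points among the half-integers\<close>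

lemma half_integer_cases:
  fixes b :: rat
  assumes "2 * b \<in> \<int>" "\<bar>b\<bar> \<le> 1"
  shows "b \<in> {0, 1, -1, 1/2, -1/2}"
proof -
  obtain c :: int where c: "2 * b = of_int c"
    using assms(1) by (elim Ints_cases)
  with assms(2) have "(of_int \<bar>c\<bar> :: rat) \<le> of_int 2"
    by simp
  then have "\<bar>c\<bar> \<le> 2"
    by (simp only: of_int_le_iff)
  then have "c = 0 \<or> c = 1 \<or> c = 2 \<or> c = -1 \<or> c = -2"
    by linarith
  moreover have "b = of_int c / 2"
    using c by simp
  ultimately show ?thesis by auto
qed

text \<open>The four points are cos theta for theta = pi/2, pi, pi/3 and 2 pi/3, and the value there
  is cos (n theta), so each condition depends only on a residue of n.\<close>

lemma chebyshev_T_fixpoint_iff: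
  fixes n :: nat
  shows "poly (chebyshev_T n) (0 :: 'a::field_char_0) = 0 \<longleftrightarrow> gcd n 2 = 1"
    and "poly (chebyshev_T n) (- 1 :: 'a) = - 1 \<longleftrightarrow> gcd n 2 = 1"
    and "poly (chebyshev_T n) (1/2 :: 'a) = 1/2 \<longleftrightarrow> gcd n 6 = 1"
    and "poly (chebyshev_T n) (- 1/2 :: 'a) = - 1/2 \<longleftrightarrow> gcd n 3 = 1"
proof -
  have odd_iff: "gcd n 2 = 1 \<longleftrightarrow> odd n" for n :: nat
    using coprime_right_2_iff_odd [of n] by (simp add: coprime_iff_gcd_eq_1)
  show "poly (chebyshev_T n) (0 :: 'a) = 0 \<longleftrightarrow> gcd n 2 = 1"
    unfolding odd_iff by (induction n rule: chebyshev_T.induct) simp_all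
  show "poly (chebyshev_T n) (- 1 :: 'a) = - 1 \<longleftrightarrow> gcd n 2 = 1"
    unfolding odd_iff poly_chebyshev_T_minus_one by (cases "even n") simp_all
  show "poly (chebyshev_T n) (1/2 :: 'a) = 1/2 \<longleftrightarrow> gcd n 6 = 1"
  proof (induction n rule: less_induct)
    case (less n)
    have gcd: "gcd 2 6 = (2 :: nat)" "gcd 3 6 = (3 :: nat)" "gcd 4 6 = (2 :: nat)" "gcd 5 6 = (1 :: nat)"
      by (simp_all add: gcd_non_0_nat)
    have T: "poly (chebyshev_T 2) (1/2 :: 'a) = -1/2" "poly (chebyshev_T 3) (1/2 :: 'a) = -1"
      "poly (chebyshev_T 4) (1/2 :: 'a) = -1/2" "poly (chebyshev_T 5) (1/2 :: 'a) = 1/2"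
      by (simp_all add: eval_nat_numeral field_simps)
    consider "n \<in> {0, 1, 2, 3, 4, 5}" | k where "n = k + 6"
    proof (cases "n < 6")
      case True
      then have "n \<in> {0, 1, 2, 3, 4, 5}" by auto
      then show ?thesis by (rule that(1))
    next
      case False
      then have "n = (n - 6) + 6" by simp
      then show ?thesis by (rule that(2))
    qed
    then show ?case
    proof cases
      case 1
      then show ?thesis by (auto simp: gcd T)
    next
      case 2
      \<comment> \<open>Three steps add pi to the angle and flip the sign; doing this twice gives
        period 6.\<close>
      have "poly (chebyshev_T (j + 3)) (1/2 :: 'a) = - poly (chebyshev_T j) (1/2)" for j
        by (simp add: eval_nat_numeral diff_divide_distrib)
      from this [of k] this [of "k + 3"]
      have "poly (chebyshev_T (k + 6)) (1/2 :: 'a) = poly (chebyshev_T k) (1/2)"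
        by (simp add: add.assoc)
      with 2 less [of k] show ?thesis by simp
    qed
  qed
  show "poly (chebyshev_T n) (- 1/2 :: 'a) = - 1/2 \<longleftrightarrow> gcd n 3 = 1"
  proof (induction n rule: less_induct)
    case (less n)
    consider "n \<in> {0, 1, 2}" | k where "n = k + 3"
    proof (cases "n < 3")
      case True
      then have "n \<in> {0, 1, 2}" by auto
      then show ?thesis by (rule that(1))
    next
      case False
      then have "n = (n - 3) + 3" by simp
      then show ?thesis by (rule that(2))
    qed
    then show ?case
    proof cases
      case 1
      then show ?thesis by (auto simp: eval_nat_numeral field_simps)
    next
      case 2
      have "poly (chebyshev_T (k + 3)) (- 1/2 :: 'a) = poly (chebyshev_T k) (- 1/2)"
        by (simp add: eval_nat_numeral diff_divide_distrib)
      with 2 less [of k] show ?thesis by simp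
    qed
  qed
qed

subsection \<open>Common roots for coprime indices\<close>

lemma power_eq_1_coprime:
  fixes z :: "'a::monoid_mult"
  assumes "z ^ m = 1" "z ^ n = 1" "coprime m n" "m \<noteq> 0"
  shows "z = 1"
proof -
  obtain x y where "m * x = n * y + 1"
    using bezout_nat [OF assms(4), of n] assms(3) by auto
  then have "z ^ (m * x) = z ^ (n * y) * z"
    by (simp add: power_commutes)
  then show ?thesis
    by (simp add: power_mult assms)
qed

text \<open>Both u and v are roots of one quadratic whose roots have product 1.\<close>

lemma add_inverse_eq_cases:
  fixes u v :: "'a::field"
  assumes "u \<noteq> 0" "v \<noteq> 0" "u + inverse u = v + inverse v"
  shows "u = v \<or> u * v = 1"
proof -
  have "(u - v) * (u * v - 1) = 0"
    using assms by (simp add: field_simps)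
  then show ?thesis by auto
qed

text \<open>Comparing norms, |z| to the power n - m or n + m is 1. Both exponents are positive, so
  |z| = 1, and the triangle inequality bounds 2 |b| by 2.\<close>

lemma common_root_abs_le:
  fixes b :: rat and t :: complex
  assumes "0 < m" "m < n"
    and "poly (chebyshev_T m) t = of_rat b" "poly (chebyshev_T n) t = of_rat b"
  shows "\<bar>b\<bar> \<le> 1"
proof -
  obtain z where z: "z \<noteq> 0" "t = (z + inverse z) / 2"
    by (rule joukowski_surj)
  have zm: "z ^ m + inverse (z ^ m) = 2 * of_rat b" and zn: "z ^ n + inverse (z ^ n) = 2 * of_rat b"
    using poly_chebyshev_T_joukowski [OF z(1)] assms z(2) by (metis power_inverse)+
  have "z ^ n = z ^ m \<or> z ^ n * z ^ m = 1"
    using z(1) zm zn by (intro add_inverse_eq_cases) auto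
  then have "norm z ^ n = norm z ^ m \<or> norm z ^ (n + m) = 1"
    by (metis norm_mult norm_one norm_power power_add)
  then have "norm z ^ (n - m) = 1 \<or> norm z ^ (n + m) = 1"
    using assms(2) z(1) by (auto simp: power_diff)
  then have "norm z = 1"
    using assms(1,2) power_eq_imp_eq_base [of "norm z" _ 1] by auto
  have "norm (2 * of_rat b :: complex) \<le> norm (z ^ m) + norm (inverse (z ^ m))"
    unfolding zm [symmetric] by (rule norm_triangle_ineq)
  also have "\<dots> = 2"
    by (simp add: norm_power norm_inverse \<open>norm z = 1\<close>)
  finally have "norm (of_rat b :: complex) \<le> 1"
    by (simp add: norm_mult)
  moreover have "norm (of_rat b :: complex) = of_rat \<bar>b\<bar>"
    by (cases b) (simp add: of_rat_rat norm_divide)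
  ultimately show ?thesis by simp
qed

text \<open>In each case all roots of u^2 - 2 b u + 1 are k-th roots of unity for some fixed k,
  hence so is z. Factoring z^k - 1 and excluding the other factors by means of \<open>a\<close>
  leaves z^2 - 2 b z + 1 = 0.\<close>

lemma common_root_eq:
  fixes b :: rat and t :: complex
  assumes "0 < m" "coprime m n" "b \<in> {0, 1, -1, 1/2, -1/2}"
    and "poly (chebyshev_T m) t = of_rat b" "poly (chebyshev_T n) t = of_rat b"
  shows "t = of_rat b"
proof -
  obtain z where z: "z \<noteq> 0" "t = (z + inverse z) / 2"
    by (rule joukowski_surj)
  have zm: "z ^ m + inverse (z ^ m) = 2 * of_rat b" and zn: "z ^ n + inverse (z ^ n) = 2 * of_rat b"
    using poly_chebyshev_T_joukowski [OF z(1)] assms z(2) by (metis power_inverse)+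
  define a where "a = z ^ m"
  have quadratic: "u * u + 1 = 2 * of_rat b * u" if "u \<noteq> 0" "u + inverse u = 2 * of_rat b" for u :: complex
  proof -
    have "u * u + 1 = (u + inverse u) * u"
      using that(1) by (simp add: distrib_right)
    then show ?thesis
      by (simp only: that(2))
  qed
  have a: "a * a + 1 = 2 * of_rat b * a"
    using quadratic [OF _ zm] z(1) by (simp add: a_def)
  \<comment> \<open>The hypothesis applies to both z^m and z^n, so the m-th and n-th powers of z^k
    are 1, and coprimality gives z^k = 1.\<close>
  have root: "z ^ k = 1" if "\<And>u :: complex. u * u + 1 = 2 * of_rat b * u \<Longrightarrow> u ^ k = 1" for k
  proof (rule power_eq_1_coprime)
    have "(z ^ l) ^ k = 1" if "z ^ l + inverse (z ^ l) = 2 * of_rat b" for l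
      using that z(1) by (intro \<open>\<And>u. _ \<Longrightarrow> u ^ k = 1\<close> quadratic) auto
    from this [OF zm] this [OF zn] show "(z ^ k) ^ m = 1" "(z ^ k) ^ n = 1"
      by (metis power_mult mult.commute)+
  qed (use assms in auto)
  have ak: "a ^ k = (z ^ k) ^ m" for k
    by (simp add: a_def mult.commute flip: power_mult)
  have t: "t = of_rat b" if "z * z + 1 = 2 * of_rat b * z"
    using that z by (simp add: field_simps)
  from assms(3) consider "b = 0" | "b = 1" | "b = -1" | "b = 1/2" | "b = -1/2"
    by auto
  then show ?thesis
  proof cases
    case 1
    have quartic: "u ^ 4 = 1" if "u * u + 1 = 2 * of_rat b * u" for u :: complex
    proof -
      have "u ^ 4 - 1 = (u * u + 1) * (u * u - 1)"
        by (simp add: eval_nat_numeral algebra_simps)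
      then show ?thesis
        using that 1 by simp
    qed
    have "(z ^ 2 - 1) * (z ^ 2 + 1) = z ^ 4 - 1"
      by (simp add: algebra_simps eval_nat_numeral)
    also have "\<dots> = 0"
      using root [OF quartic] by simp
    finally have "(z ^ 2 - 1) * (z ^ 2 + 1) = 0" .
    \<comment> \<open>Otherwise a^2 = 1, whereas the quadratic for \<open>a\<close> gives a^2 =
      -1.\<close>
    moreover have "z ^ 2 \<noteq> 1"
      using ak [of 2] a 1 by (auto simp: power2_eq_square)
    ultimately have "z ^ 2 + 1 = 0" by auto
    then show ?thesis
      using t 1 by (simp add: power2_eq_square)
  next
    case 2
    have "z ^ 1 = 1"
    proof (rule root)
      fix u :: complex
      assume "u * u + 1 = 2 * of_rat b * u"
      then have "(u - 1) * (u - 1) = 0"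
        using 2 by (simp add: algebra_simps)
      then show "u ^ 1 = 1" by simp
    qed
    then show ?thesis
      using t 2 by simp
  next
    case 3
    have a: "a = - 1" and root': "z ^ 2 = 1"
    proof -
      have *: "u = - 1" if "u * u + 1 = 2 * of_rat b * u" for u :: complex
      proof -
        have "(u + 1) * (u + 1) = (u * u + 1) + 2 * u"
          by (simp add: algebra_simps)
        also have "\<dots> = 0"
          unfolding that by (simp add: 3 of_rat_minus)
        finally show ?thesis by (simp add: add_eq_0_iff2)
      qed
      show "a = - 1" using * a by blast
      show "z ^ 2 = 1" by (rule root) (drule *, simp)
    qed
    have "z \<noteq> 1"
      using a by (auto simp: a_def)
    with root' have "z = - 1"
      by (simp add: power2_eq_1_iff)
    then show ?thesis
      using t 3 by (simp add: of_rat_minus)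
  next
    case 4
    have b: "2 * of_rat b = (1 :: complex)"
      unfolding 4 by (simp add: of_rat_divide)
    have cube: "u ^ 3 = - 1" if "u * u + 1 = 2 * of_rat b * u" for u :: complex
    proof -
      have "u ^ 3 + 1 = (u + 1) * (u * u + 1 - u)"
        by (simp add: eval_nat_numeral algebra_simps)
      then show ?thesis
        using that unfolding b by (simp add: add_eq_0_iff2)
    qed
    have "u ^ (3 * 2) = 1" if "u * u + 1 = 2 * of_rat b * u" for u :: complex
      unfolding power_mult cube [OF that] by simp
    then have "(z ^ 3) ^ 2 = 1"
      unfolding power_mult [symmetric] by (rule root)
    \<comment> \<open>Otherwise a^3 = 1, against \<open>cube\<close>.\<close>
    moreover have "z ^ 3 \<noteq> 1"
      using ak [of 3] cube [OF a] by auto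
    ultimately have "z ^ 3 = - 1"
      by (simp only: power2_eq_1_iff) simp
    moreover have "(z + 1) * (z * z + 1 - z) = z ^ 3 + 1"
      by (simp add: algebra_simps eval_nat_numeral)
    ultimately have "(z + 1) * (z * z + 1 - z) = 0"
      by simp
    moreover have "z \<noteq> - 1"
    proof
      assume "z = - 1"
      then have "a = 1 \<or> a = - 1"
        by (cases "even m") (auto simp: a_def)
      with a show False
        unfolding b by auto
    qed
    ultimately show ?thesis
      using t unfolding b by (simp add: add_eq_0_iff2)
  next
    case 5
    have b: "2 * of_rat b = (- 1 :: complex)"
      unfolding 5 by (simp add: of_rat_divide of_rat_minus)
    have "u ^ 3 = 1" if "u * u + 1 = 2 * of_rat b * u" for u :: complex
    proof -
      have "u ^ 3 - 1 = (u - 1) * (u * u + 1 + u)"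
        by (simp add: eval_nat_numeral algebra_simps)
      then show ?thesis
        using that unfolding b by simp
    qed
    then have "z ^ 3 = 1"
      by (rule root)
    moreover have "(z - 1) * (z * z + 1 + z) = z ^ 3 - 1"
      by (simp add: algebra_simps eval_nat_numeral)
    ultimately have "(z - 1) * (z * z + 1 + z) = 0"
      by simp
    moreover have "z \<noteq> 1"
      using a unfolding b by (auto simp: a_def)
    ultimately show ?thesis
      using t unfolding b by (simp add: add_eq_0_iff2)
  qed
qed

lemma chebyshev_common_root:
  fixes b :: rat and t :: complex
  assumes "2 * b \<in> \<int>" "0 < m" "m < n" "coprime m n"
    and "poly (chebyshev_T m) t = of_rat b" "poly (chebyshev_T n) t = of_rat b"
  shows "t = of_rat b" "b \<in> {0, 1, -1, 1/2, -1/2}"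
    and "poly (chebyshev_T m) b = b" "poly (chebyshev_T n) b = b"
proof -
  show b: "b \<in> {0, 1, -1, 1/2, -1/2}"
    using assms common_root_abs_le half_integer_cases by metis
  show t: "t = of_rat b"
    using assms b common_root_eq by metis
  have "(of_rat (poly (chebyshev_T k) b) :: complex) = poly (chebyshev_T k) (of_rat b)" for k
    by (metis map_poly_of_rat_chebyshev_T poly_map_poly_of_rat)
  with assms(5,6) t show "poly (chebyshev_T m) b = b" "poly (chebyshev_T n) b = b"
    by (metis of_rat_eq_iff)+
qed

subsection \<open>The greatest common divisor for coprime indices\<close>

text \<open>Stated for any divisor \<open>q\<close> of the gcd so that it serves both the gcd itself
  and its cofactor after splitting off x - b.\<close>

lemma gcd_chebyshev_T_root:
  fixes b :: rat and t :: complex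
  defines "P \<equiv> \<lambda>k. smult 2 (chebyshev_T k) - [:2 * b:]"
  assumes "poly (map_poly of_rat q) t = 0" "q dvd gcd (P m) (P n)"
  shows "poly (chebyshev_T m) t = of_rat b" "poly (chebyshev_T n) t = of_rat b"
proof -
  have "poly (chebyshev_T k) t = of_rat b" if "q dvd P k" for k
  proof -
    obtain r where "P k = q * r"
      using \<open>q dvd P k\<close> by (rule dvdE)
    then have "poly (map_poly of_rat (P k)) t = 0"
      using assms(2) by (simp add: map_poly_of_rat_mult)
    then show ?thesis
      by (simp add: P_def map_poly_of_rat_diff map_poly_of_rat_smult map_poly_of_rat_chebyshev_T
          map_poly_pCons of_rat_mult)
  qed
  with assms(3) show "poly (chebyshev_T m) t = of_rat b" "poly (chebyshev_T n) t = of_rat b"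
    by auto
qed

text \<open>A complex root of the cofactor \<open>q\<close> of x - b would again be b, making b a
  double root of \<open>P m\<close>; but b is a simple root. So \<open>q\<close> is
  constant.\<close>

lemma gcd_chebyshev_T_minus_const:
  fixes b :: rat
  defines "P \<equiv> \<lambda>k. smult 2 (chebyshev_T k) - [:2 * b:]"
  assumes "2 * b \<in> \<int>" "0 < m" "m < n" "coprime m n"
    and fixpoint: "poly (chebyshev_T m) b = b" "poly (chebyshev_T n) b = b"
  shows "gcd (P m) (P n) = [:-b, 1:]"
proof -
  have deriv: "poly (pderiv (P m)) b \<noteq> 0"
    using chebyshev_T_fixpoint_simple [OF fixpoint(1)] assms(3)
    by (simp add: P_def pderiv_diff pderiv_smult pderiv_pCons)
  have "[:-b, 1:] dvd gcd (P m) (P n)"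
    using fixpoint by (simp add: P_def flip: poly_eq_0_iff_dvd)
  then obtain q where q: "gcd (P m) (P n) = [:-b, 1:] * q"
    by (elim dvdE)
  have "degree q = 0"
  proof (rule ccontr)
    assume "degree q \<noteq> 0"
    then obtain t :: complex where t: "poly (map_poly of_rat q) t = 0"
      by (auto elim: map_poly_of_rat_root_exists)
    have "q dvd gcd (P m) (P n)"
      unfolding q by (rule dvd_triv_right)
    then have "t = of_rat b"
      using chebyshev_common_root(1) [OF assms(2-5)] gcd_chebyshev_T_root [OF t] unfolding P_def by metis
    with t have "poly q b = 0"
      by (simp add: poly_map_poly_of_rat)
    moreover have "[:-b, 1:] * q dvd P m"
      unfolding q [symmetric] by (rule gcd_dvd1)
    then obtain r where "P m = [:-b, 1:] * q * r"
      by (elim dvdE)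
    ultimately have "poly (pderiv (P m)) b = 0"
      by (simp add: pderiv_mult pderiv_pCons del: mult_pCons_left)
    with deriv show False ..
  qed
  moreover have "q \<noteq> 0"
    using q deriv by auto
  ultimately have "is_unit q"
    by (simp add: is_unit_iff_degree)
  have "gcd (P m) (P n) = normalize ([:-b, 1:] * q)"
    unfolding q [symmetric] by (rule normalize_gcd [symmetric])
  also have "\<dots> = [:-b, 1:]"
    using \<open>is_unit q\<close> by (simp add: normalize_mult_unit_right normalize_rat_poly_monic del: mult_pCons_left)
  finally show ?thesis .
qed

lemma coprime_chebyshev_T_minus_const:
  fixes b :: rat
  defines "P \<equiv> \<lambda>k. smult 2 (chebyshev_T k) - [:2 * b:]"
  assumes "2 * b \<in> \<int>" "0 < m" "m < n" "coprime m n"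
    and "\<not> (b \<in> {0, 1, -1, 1/2, -1/2} \<and> poly (chebyshev_T m) b = b \<and> poly (chebyshev_T n) b = b)"
  shows "gcd (P m) (P n) = 1"
proof -
  have no_root: False if "poly (map_poly of_rat (gcd (P m) (P n))) t = 0" for t :: complex
    using chebyshev_common_root [OF assms(2-5)] assms(6) that
      gcd_chebyshev_T_root [OF that [unfolded P_def] dvd_refl] by metis
  then have "degree (gcd (P m) (P n)) = 0"
    by (metis map_poly_of_rat_root_exists neq0_conv)
  \<comment> \<open>The zero polynomial also has degree 0, but it would vanish everywhere.\<close>
  moreover have "gcd (P m) (P n) \<noteq> 0"
    using no_root by auto
  ultimately have "is_unit (gcd (P m) (P n))"
    by (metis is_unit_iff_degree)
  then show ?thesis
    by (simp only: is_unit_gcd coprime_iff_gcd_eq_1)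
qed

lemma fixpoint_condition_iff:
  fixes b :: rat
  shows "(b \<in> {0, 1, -1, 1/2, -1/2} \<and> poly (chebyshev_T m) b = b \<and> poly (chebyshev_T n) b = b)
    \<longleftrightarrow> (b = 0 \<and> gcd m 2 = 1 \<and> gcd n 2 = 1
        \<or> b = 1
        \<or> b = -1 \<and> gcd m 2 = 1 \<and> gcd n 2 = 1
        \<or> b = 1/2 \<and> gcd m 6 = 1 \<and> gcd n 6 = 1
        \<or> b = -1/2 \<and> gcd m 3 = 1 \<and> gcd n 3 = 1)"
proof -
  note iff = chebyshev_T_fixpoint_iff [where ?'a = rat]
  consider "b = 0" | "b = 1" | "b = -1" | "b = 1/2" | "b = -1/2" | "b \<notin> {0, 1, -1, 1/2, -1/2}"
    by blast
  then show ?thesis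
  proof cases
    case 1
    show ?thesis unfolding 1 iff by simp
  next
    case 2
    show ?thesis unfolding 2 by (simp add: poly_chebyshev_T_one)
  next
    case 3
    show ?thesis unfolding 3 iff by simp
  next
    case 4
    show ?thesis unfolding 4 iff by simp
  next
    case 5
    show ?thesis unfolding 5 iff by simp
  next
    case 6
    then show ?thesis by simp
  qed
qed

subsection \<open>Shifted Chebyshev polynomials\<close>

text \<open>Since T_(d k) = T_k o T_d, the inner polynomial depends on d alone, so
  \<open>gcd_pcompose\<close> applies to two multiples of d.\<close>

lemma shifted_chebyshev_mult:
  "shifted_chebyshev b (d * k)
    = pcompose (smult 2 (chebyshev_T k) - [:2 * b:]) (pcompose (chebyshev_T d) [:b, 1/2:])"
  by (simp add: shifted_chebyshev_def pcompose_diff pcompose_smult pcompose_assoc chebyshev_T_pcompose)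

lemma shifted_chebyshev_monic:
  assumes "n > 0"
  shows "lead_coeff (shifted_chebyshev b n) = 1"
proof -
  obtain k where n: "n = Suc k"
    using assms by (cases n) auto
  have "coeff (chebyshev_T n :: rat poly) n = 2 ^ k"
    by (simp add: n coeff_chebyshev_T del: chebyshev_T.simps)
  moreover from this have deg: "degree (chebyshev_T n :: rat poly) = n"
    by (intro antisym degree_chebyshev_T_le le_degree) simp
  ultimately have "lead_coeff (pcompose (chebyshev_T n) [:b, 1/2:]) = 2 ^ k * (1/2) ^ n"
    by (subst lead_coeff_comp) simp_all
  moreover have deg': "degree (pcompose (chebyshev_T n) [:b, 1/2:]) = n"
    by (simp add: degree_pcompose deg)
  \<comment> \<open>The powers of 2 cancel as 2 * 2^k * (1/2)^(k + 1) = 1; the constant 2 b does not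
    interfere because n > 0.\<close>
  ultimately have c: "coeff (shifted_chebyshev b n) n = 1"
    by (simp add: shifted_chebyshev_def n power_divide)
  have "degree (shifted_chebyshev b n) \<le> n"
    unfolding shifted_chebyshev_def by (intro degree_diff_le) (simp_all add: deg')
  with c have "degree (shifted_chebyshev b n) = n"
    by (intro antisym le_degree) simp_all
  with c show ?thesis by simp
qed

theorem corollary2p14:
  fixes b :: rat and m n d m1 n1 :: nat
  assumes "2 * b \<in> \<int>"
    and "0 < m" and "m < n"
    and "d = gcd m n" and "m = d * m1" and "n = d * n1"
  shows "if b = 0 \<and> gcd m1 2 = 1 \<and> gcd n1 2 = 1
            \<or> b = 1
            \<or> b = -1 \<and> gcd m1 2 = 1 \<and> gcd n1 2 = 1
            \<or> b = 1/2 \<and> gcd m1 6 = 1 \<and> gcd n1 6 = 1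
            \<or> b = -1/2 \<and> gcd m1 3 = 1 \<and> gcd n1 3 = 1
         then gcd (shifted_chebyshev b m) (shifted_chebyshev b n) = shifted_chebyshev b d
         else coprime (shifted_chebyshev b m) (shifted_chebyshev b n)"
proof -
  define P where "P = (\<lambda>k. smult 2 (chebyshev_T k) - [:2 * b:] :: rat poly)"
  define S where "S = pcompose (chebyshev_T d) [:b, 1/2:]"
  have d: "d > 0" and m1: "0 < m1" and lt: "m1 < n1"
    using assms(2,3,5,6) by auto
  have "d * gcd m1 n1 = d * 1"
    using assms(4) gcd_mult_distrib_nat [of d m1 n1] unfolding assms(5,6) [symmetric] by simp
  with d have cop: "coprime m1 n1"
    by (simp add: coprime_iff_gcd_eq_1)
  have gcd_f: "gcd (shifted_chebyshev b m) (shifted_chebyshev b n) = normalize (pcompose (gcd (P m1) (P n1)) S)"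
    unfolding assms(5,6) shifted_chebyshev_mult by (simp add: gcd_pcompose P_def S_def)
  have "gcd (shifted_chebyshev b m) (shifted_chebyshev b n) = shifted_chebyshev b d"
    if "poly (chebyshev_T m1) b = b" "poly (chebyshev_T n1) b = b"
  proof -
    have "gcd (P m1) (P n1) = [:-b, 1:]"
      unfolding P_def by (rule gcd_chebyshev_T_minus_const) fact+
    \<comment> \<open>Normalization ignores the scalar 2, which is inserted because 2 (S - b) is
      exactly f_d.\<close>
    then have "gcd (shifted_chebyshev b m) (shifted_chebyshev b n) = normalize (smult 2 (pcompose [:-b, 1:] S))"
      by (simp add: gcd_f normalize_smult)
    also have "smult 2 (pcompose [:-b, 1:] S) = shifted_chebyshev b d"
      by (simp add: shifted_chebyshev_def S_def pcompose_pCons smult_add_right)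
    also have "normalize \<dots> = \<dots>"
      using shifted_chebyshev_monic [OF d] by (rule normalize_rat_poly_monic)
    finally show ?thesis .
  qed
  moreover have "coprime (shifted_chebyshev b m) (shifted_chebyshev b n)"
    if "\<not> (b \<in> {0, 1, -1, 1/2, -1/2} \<and> poly (chebyshev_T m1) b = b \<and> poly (chebyshev_T n1) b = b)"
  proof -
    have "gcd (P m1) (P n1) = 1"
      unfolding P_def by (rule coprime_chebyshev_T_minus_const) fact+
    then show ?thesis
      by (simp add: gcd_f pcompose_1 coprime_iff_gcd_eq_1)
  qed
  ultimately show ?thesis
    unfolding fixpoint_condition_iff [symmetric] by auto
qed

end
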